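(* $$\lim_{X\to+\infty}\frac{\#\{0\le n\le X:\ \mathcal{J}_{10}(4n+1)\equiv 0\pmod 2\}}{X}=1.$$
   Context: Let $q=e^{2\pi i\tau}$, $(a;q)_\infty=\prod_{j\ge0}(1-aq^j)$, and $\eta(\tau)=q^{1/24}(q;q)_\infty$. Define $$j_{10}(\tau)=\frac{\eta(2\tau)\eta(5\tau)^5}{\eta(\tau)\eta(10\tau)^5}-1=\frac1q+\sum_{n\ge0}\mathcal{J}_{10}(n)q^n.$$ *)

theory Defs
  imports "HOL-Analysis.Analysis" "HOL-Computational_Algebra.Formal_Power_Series"
begin

text \<open>The q-Pochhammer symbol (q^k;q^k)_infinity = prod_{j>=1} (1 - q^(k j)) as a formal power
  series in q. Its n-th coefficient only depends on the factors with k j <= n, so it equals the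
  n-th coefficient of the finite product over j = 1..n+1 (for k >= 1).\<close>
definition qpoch :: "nat \<Rightarrow> rat fps" where
  "qpoch k = Abs_fps (\<lambda>n. fps_nth (\<Prod>j\<in>{1..n+1}. (1 - fps_X ^ (k * j))) n)"

text \<open>F = (q^2;q^2)(q^5;q^5)^5 / ((q;q)(q^10;q^10)^5), so that
  j10 = eta(2t)eta(5t)^5/(eta(t)eta(10t)^5) - 1 = q^(-1) F - 1
  (the q-power is (2+25-1-50)/24 = -1).\<close>
definition j10_F :: "rat fps" where
  "j10_F = qpoch 2 * qpoch 5 ^ 5 * inverse (qpoch 1 * qpoch 10 ^ 5)"

text \<open>J10 n = coefficient of q^n in j10 = [q^(n+1)] F - (if n = 0 then 1 else 0).\<close>
definition J10 :: "nat \<Rightarrow> rat" where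
  "J10 n = fps_nth j10_F (n + 1) - (if n = 0 then 1 else 0)"

end

theory Submission
  imports Defs "HOL-Library.Z2" "HOL-Computational_Algebra.Formal_Laurent_Series"
    "HOL-Real_Asymp.Real_Asymp"
begin

text \<open>
  Write $f_k = (q^k; q^k)_\infty$ and work over the field with two elements, where
  $f_{2k} = f_k^2$. There $q (j_{10} + 1) = F$ with $F f_5^5 = f_1$, so $F f_5^8 = f_1 f_5^3$.
  The point is the 2-dissection $f_1 f_5 = f_2^3 + q f_{10}^3$ modulo 2. Extracting the
  even-indexed part of $F f_5^8 = (f_1 f_5) f_5^2$ gives $f_1^3 f_5$ and then the odd-indexed
  part of $f_1^3 f_5 = (f_1 f_5) f_1^2$ gives $f_1 f_5^3$, so the coefficients of $q^{4n+2}$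
  in $F$ form the series $f_1 f_5$ itself. Since $f_1^3$ is the series of triangular numbers,
  the dissection shows that $f_1 f_5$ is supported on those $n$ for which $4n+1$ is a square
  or five times a square, a set of density zero.

  The dissection is a count of the solutions of $x^2 + 5y^2 = 24N + 6$ given by Euler's
  pentagonal number theorem; division by $1 + \sqrt{-5}$ turns it into $u^2 + 5v^2 = 4N + 1$,
  whose solutions are paired off by involutions. In the same way, $f_1^3$ is found by counting
  the solutions of $3x^2 + y^2 = 24N + 4$.
\<close>

text \<open>The simplification rules of \<^theory>\<open>HOL-Library.Z2\<close> replace the field operations by
  bit operations, which blocks all algebraic reasoning.\<close>
declare add_bit_eq_xor [simp del] mult_bit_eq_and [simp del] minus_bit_def [simp del]
  divide_bit_def [simp del] uminus_bit_def [simp del] inverse_bit_def [simp del]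
  power_bit_unfold [simp del]

section \<open>Parity counts and power series over the field with two elements\<close>

lemma bit_add_self: "a + a = (0::bit)"
  by (metis bit_2_eq_0 mult_2 mult_zero_left)

lemma bit_fps_add_self: "F + F = (0 :: bit fps)"
  by (simp add: fps_eq_iff bit_add_self)

lemma bit_fps_uminus: "- F = (F :: bit fps)"
  by (metis bit_fps_add_self neg_eq_iff_add_eq_0)

lemma bit_of_nat: "(of_nat n :: bit) = of_bool (odd n)"
  by (induction n) (auto simp: bit_add_self)

lemma bit_of_int: "(of_int a :: bit) = of_bool (odd a)"
proof (cases "even a")
  case True then show ?thesis by (auto elim!: evenE)
next
  case False then show ?thesis by (auto elim!: oddE)
qed

text \<open>Elements that are not fixed fall into pairs \<open>{x, f x}\<close>, and the induction
  removes one such pair at a time. All the parity counts below rest on this.\<close>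

lemma card_involution_cong:
  fixes f :: "'a \<Rightarrow> 'a"
  assumes "finite S" "\<And>x. x \<in> S \<Longrightarrow> f x \<in> S" "\<And>x. x \<in> S \<Longrightarrow> f (f x) = x"
  shows "even (card S) \<longleftrightarrow> even (card {x \<in> S. f x = x})"
  using assms
proof (induction S rule: finite_psubset_induct)
  case (psubset S)
  show ?case
  proof (cases "\<exists>x\<in>S. f x \<noteq> x")
    case False
    then have "{x \<in> S. f x = x} = S" by auto
    then show ?thesis by simp
  next
    case True
    then obtain x where x: "x \<in> S" "f x \<noteq> x" by blast
    define T where "T = S - {x, f x}"
    have fx: "f x \<in> S" "f (f x) = x" using psubset.prems x by auto
    have "card S = card T + 2"
    proof -
      have "card T = card S - card {x, f x}"
        unfolding T_def by (rule card_Diff_subset) (use x fx in auto)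
      moreover have "card {x, f x} \<le> card S"
        using x fx psubset.hyps by (intro card_mono) auto
      ultimately show ?thesis using x by simp
    qed
    moreover have "{x \<in> S. f x = x} = {x \<in> T. f x = x}"
      using x fx by (auto simp: T_def)
    moreover have "even (card T) \<longleftrightarrow> even (card {x \<in> T. f x = x})"
    proof (rule psubset.IH)
      show "T \<subset> S" using x by (auto simp: T_def)
      show "f y \<in> T" if "y \<in> T" for y
        using that psubset.prems fx unfolding T_def by (metis DiffD1 DiffD2 DiffI insertCI insertE singletonD)
      show "f (f y) = y" if "y \<in> T" for y
        using that psubset.prems by (auto simp: T_def)
    qed
    ultimately show ?thesis by simp
  qed
qed

text \<open>The convolution sum consists of zeros and ones, so its value is the parity of the number
  of nonzero terms. Identities between products thereby become statements about counting.\<close>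

lemma bit_fps_mult_nth:
  fixes F G :: "bit fps"
  shows "fps_nth (F * G) N =
    of_bool (odd (card {(i, k). i + k = N \<and> fps_nth F i = 1 \<and> fps_nth G k = 1}))"
proof -
  let ?A = "{i \<in> {0..N}. fps_nth F i = 1 \<and> fps_nth G (N - i) = 1}"
  have "fps_nth (F * G) N = (\<Sum>i=0..N. of_bool (fps_nth F i = 1 \<and> fps_nth G (N - i) = 1))"
    unfolding fps_mult_nth
    by (intro sum.cong refl) (use bit_not_one_iff in fastforce)
  also have "\<dots> = of_nat (card ?A)"
    by (simp add: sum.If_cases of_bool_def Int_def)
  also have "card ?A = card {(i, k). i + k = N \<and> fps_nth F i = 1 \<and> fps_nth G k = 1}"
    by (rule bij_betw_same_card[of "\<lambda>i. (i, N - i)"], rule bij_betwI[of _ _ _ fst]) auto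
  finally show ?thesis by (simp add: bit_of_nat)
qed

text \<open>Swapping the two indices pairs off all contributions except the diagonal one: this is
  the Frobenius map \<open>F(q)^2 = F(q^2)\<close>.\<close>

lemma bit_fps_square_nth:
  fixes F :: "bit fps"
  shows "fps_nth (F\<^sup>2) n = (if even n then fps_nth F (n div 2) else 0)"
proof -
  let ?S = "{(i, k). i + k = n \<and> fps_nth F i = 1 \<and> fps_nth F k = 1}"
  let ?D = "{(i, k). i = k \<and> 2 * i = n \<and> fps_nth F i = 1}"
  have "finite ?S" by (rule finite_subset[of _ "{..n} \<times> {..n}"]) auto
  then have "even (card ?S) \<longleftrightarrow> even (card {x \<in> ?S. prod.swap x = x})"
    by (rule card_involution_cong) auto
  also have "{x \<in> ?S. prod.swap x = x} = ?D"
    unfolding set_eq_iff mem_Collect_eq case_prod_beta prod_eq_iff by (simp only: fst_swap snd_swap) (metis mult_2)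
  finally have *: "fps_nth (F\<^sup>2) n = of_bool (odd (card ?D))"
    unfolding power2_eq_square bit_fps_mult_nth by (rule arg_cong)
  show ?thesis
  proof (cases "even n \<and> fps_nth F (n div 2) = 1")
    case True
    then have "?D = {(n div 2, n div 2)}" by auto
    with True * show ?thesis by simp
  next
    case False
    then have "?D = {}" by auto
    with False * show ?thesis by (simp split: if_splits)
  qed
qed

section \<open>Extraction of the even and odd parts of a series\<close>

definition fps_section :: "nat \<Rightarrow> 'a fps \<Rightarrow> 'a fps" where
  "fps_section r F = Abs_fps (\<lambda>n. fps_nth F (2 * n + r))"

lemma fps_section_nth [simp]: "fps_nth (fps_section r F) n = fps_nth F (2 * n + r)"
  by (simp add: fps_section_def)

text \<open>Since \<open>G^2\<close> is a series in \<open>q^2\<close>, it behaves like a scalar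
  under the extraction and leaves as \<open>G\<close> once \<open>q^2\<close> is renamed to
  \<open>q\<close>.\<close>

lemma fps_section_mult_square:
  fixes F G :: "bit fps"
  assumes "r < 2"
  shows "fps_section r (F * G\<^sup>2) = fps_section r F * G"
proof (rule fps_ext)
  fix n
  have "fps_nth (F * G\<^sup>2) (2 * n + r) = (\<Sum>i=0..2*n+r. fps_nth (G\<^sup>2) i * fps_nth F (2 * n + r - i))"
    by (simp add: mult.commute[of F] fps_mult_nth)
  also have "\<dots> = (\<Sum>i\<in>(\<lambda>k. 2 * k) ` {0..n}. fps_nth (G\<^sup>2) i * fps_nth F (2 * n + r - i))"
  proof (rule sum.mono_neutral_right; safe?)
    fix i assume i: "i \<in> {0..2*n+r}" "i \<notin> (\<lambda>k. 2 * k) ` {0..n}"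
    have "odd i"
    proof
      assume "even i"
      then obtain k where "i = 2 * k" by (elim evenE)
      \<comment> \<open>From \<open>2 * k \<le> 2 * n + r\<close> and \<open>r < 2\<close> follows
        \<open>k \<le> n\<close>.\<close>
      with i assms show False by auto
    qed
    then show "fps_nth (G\<^sup>2) i * fps_nth F (2 * n + r - i) = 0"
      by (simp add: bit_fps_square_nth)
  qed auto
  also have "\<dots> = (\<Sum>k=0..n. fps_nth G k * fps_nth F (2 * (n - k) + r))"
    by (subst sum.reindex) (auto simp: inj_on_def bit_fps_square_nth diff_mult_distrib2 intro!: sum.cong)
  also have "\<dots> = fps_nth (fps_section r F * G) n"
    by (simp add: mult.commute[of _ G] fps_mult_nth)
  finally show "fps_nth (fps_section r (F * G\<^sup>2)) n = fps_nth (fps_section r F * G) n"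
    by simp
qed

section \<open>Euler's product and its behaviour in characteristic 2\<close>

text \<open>The construction of \<open>qpoch\<close> over an arbitrary commutative ring, so that the
  same product is available over \<open>int\<close>, \<open>rat\<close> and
  \<open>bit\<close>.\<close>

definition euler_fps :: "nat \<Rightarrow> 'a::comm_ring_1 fps" where
  "euler_fps k = Abs_fps (\<lambda>n. fps_nth (\<Prod>j\<in>{1..n+1}. (1 - fps_X ^ (k * j))) n)"

text \<open>A factor with \<open>j > n\<close> alters only coefficients of degree at least
  \<open>k * j > n\<close>, so every sufficiently long truncation gives the same
  coefficient.\<close>

lemma euler_fps_nth:
  assumes "k > 0" "n \<le> m"
  shows "fps_nth (euler_fps k :: 'a::comm_ring_1 fps) n = fps_nth (\<Prod>j\<in>{1..m}. (1 - fps_X ^ (k * j))) n"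
proof -
  have *: "fps_nth (\<Prod>j\<in>{1..n+d}. (1 - fps_X ^ (k * j)) :: 'a fps) n
        = fps_nth (\<Prod>j\<in>{1..n}. (1 - fps_X ^ (k * j))) n" for d
  proof (induction d)
    case (Suc d)
    let ?A = "\<Prod>j\<in>{1..n+d}. (1 - fps_X ^ (k * j)) :: 'a fps"
    have "(\<Prod>j\<in>{1..n+Suc d}. (1 - fps_X ^ (k * j)) :: 'a fps) = ?A - fps_X ^ (k * (n + d + 1)) * ?A"
      by (simp add: algebra_simps)
    moreover have "n < k * (n + d + 1)" using assms by (cases k) auto
    ultimately show ?case using Suc by (simp add: fps_X_power_mult_nth)
  qed simp
  show ?thesis
    using *[of 1] *[of "m - n"] assms by (simp add: euler_fps_def)
qed

lemma euler_fps_nth_0: "k > 0 \<Longrightarrow> fps_nth (euler_fps k) 0 = (1::'a::comm_ring_1)"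
  by (subst euler_fps_nth[of k 0 0]) auto

lemma euler_fps_double:
  assumes "k > 0"
  shows "euler_fps (2 * k) = (euler_fps k :: bit fps)\<^sup>2"
proof (rule fps_ext)
  fix n
  have sq: "1 - fps_X ^ (2 * k * j) = (1 - fps_X ^ (k * j) :: bit fps)\<^sup>2" for j
  proof -
    let ?Y = "fps_X ^ (k * j) :: bit fps"
    \<comment> \<open>The difference between the square and \<open>1 - ?Y\<^sup>2\<close> is written
      as a series added to itself, which vanishes in characteristic 2.\<close>
    have "(1 - ?Y)\<^sup>2 = 1 - ?Y\<^sup>2 + ((?Y\<^sup>2 - ?Y) + (?Y\<^sup>2 - ?Y))"
      by (simp add: power2_eq_square algebra_simps)
    moreover have "fps_X ^ (2 * k * j) = ?Y\<^sup>2"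
      by (metis mult.assoc mult.commute power_mult)
    ultimately show ?thesis by (simp only: bit_fps_add_self add_0_right)
  qed
  have "fps_nth (euler_fps (2 * k) :: bit fps) n = fps_nth ((\<Prod>j\<in>{1..n}. (1 - fps_X ^ (k * j)))\<^sup>2) n"
    using assms by (simp add: euler_fps_nth[of "2 * k" n n] sq prod_power_distrib del: fps_X_power_iff)
  also have "\<dots> = fps_nth ((euler_fps k)\<^sup>2) n"
    unfolding bit_fps_square_nth using assms by (simp add: euler_fps_nth[of k "n div 2" n])
  finally show "fps_nth (euler_fps (2 * k) :: bit fps) n = fps_nth ((euler_fps k)\<^sup>2) n" .
qed

lemma euler_fps_compose:
  assumes "k > 0"
  shows "euler_fps k = (euler_fps 1 :: 'a::idom fps) oo fps_X ^ k"
proof (rule fps_ext)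
  fix n
  have X0: "fps_nth (fps_X ^ k :: 'a fps) 0 = 0" using assms by simp
  have "(\<Prod>j\<in>{1..n}. (1 - fps_X ^ (k * j)) :: 'a fps) = (\<Prod>j\<in>{1..n}. (1 - fps_X ^ j)) oo fps_X ^ k"
    by (simp add: fps_compose_prod_distrib[OF X0] fps_compose_sub_distrib power_mult
        fps_X_fps_compose_startby0[OF X0] flip: fps_compose_power[OF X0])
  then have "fps_nth (euler_fps k :: 'a fps) n = (if k dvd n then fps_nth (\<Prod>j\<in>{1..n}. (1 - fps_X ^ j)) (n div k) else 0)"
    using assms by (simp add: euler_fps_nth[of k n n] fps_nth_compose_X_power)
  also have "\<dots> = fps_nth (euler_fps 1 oo fps_X ^ k) n"
    using assms by (simp add: fps_nth_compose_X_power euler_fps_nth[of "Suc 0" "n div k" n])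
  finally show "fps_nth (euler_fps k :: 'a fps) n = fps_nth (euler_fps 1 oo fps_X ^ k) n" .
qed

section \<open>Euler's pentagonal number theorem modulo 2\<close>

text \<open>Shanks, \<^emph>\<open>A short proof of an identity of Euler\<close>.\<close>

lemma shanks_partial_sum:
  "(\<Sum>s=0..n. (-1)^s * fps_X ^ (s * n + s * (s+1) div 2) * (\<Prod>j\<in>{s<..n}. 1 - fps_X^j))
    = 1 + (\<Sum>s=1..n. (-1)^s * (fps_X ^ (s * s + s * (s-1) div 2) + fps_X ^ (s * s + s * (s+1) div 2)) :: 'a::comm_ring_1 fps)"
proof (induction n)
  case (Suc n)
  define t where "t s = s * (s + 1) div 2" for s :: nat
  have t_Suc: "t (Suc s) = t s + Suc s" for s
    by (simp add: t_def)
  define P :: "nat \<Rightarrow> 'a fps" where "P s = (\<Prod>j\<in>{s<..n}. 1 - fps_X^j)" for s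
  define B where "B s = (-1)^s * fps_X ^ (Suc s * Suc n + t s) * P s" for s
  have P_Suc: "P s = (1 - fps_X^Suc s) * P (Suc s)" if "s < n" for s
  proof -
    have "{s<..n} = insert (Suc s) {Suc s<..n}" using that by auto
    then show ?thesis by (simp add: P_def)
  qed
  have "(\<Sum>s=0..Suc n. (-1)^s * fps_X ^ (s * Suc n + t s) * (\<Prod>j\<in>{s<..Suc n}. 1 - fps_X^j))
      = (\<Sum>s=0..n. (-1)^s * fps_X ^ (s * Suc n + t s) * ((1 - fps_X^Suc n) * P s))
        + (-1)^Suc n * fps_X ^ (Suc n * Suc n + t (Suc n))"
  proof -
    have "{s<..Suc n} = insert (Suc n) {s<..n}" if "s \<le> n" for s using that by auto
    then show ?thesis by (simp add: P_def)
  qed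
  \<comment> \<open>Writing \<open>q^s = 1 - (1 - q^s)\<close> splits off the sum for
    \<open>n\<close>. Of the other two sums everything cancels except \<open>B n\<close>.\<close>
  also have "(\<Sum>s=0..n. (-1)^s * fps_X ^ (s * Suc n + t s) * ((1 - fps_X^Suc n) * P s))
      = (\<Sum>s=0..n. (-1)^s * fps_X ^ (s * n + t s) * P s)
        - (\<Sum>s=0..n. (-1)^s * fps_X ^ (s * n + t s) * (1 - fps_X^s) * P s) - (\<Sum>s=0..n. B s)"
    by (simp add: B_def sum_subtractf[symmetric] algebra_simps power_add)
  also have "(\<Sum>s=0..n. (-1)^s * fps_X ^ (s * n + t s) * (1 - fps_X^s) * P s) = - (\<Sum>s<n. B s)"
  proof -
    \<comment> \<open>The term \<open>s = 0\<close> contains \<open>1 - q^0 = 0\<close>. After the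
      index shift, the factor \<open>1 - q^(s+1)\<close> is absorbed into \<open>P (Suc s)\<close>
      and gives \<open>P s\<close>.\<close>
    have "(\<Sum>s=0..n. (-1)^s * fps_X ^ (s * n + t s) * (1 - fps_X^s) * P s)
        = (\<Sum>s<n. (-1)^Suc s * fps_X ^ (Suc s * n + t (Suc s)) * (1 - fps_X^Suc s) * P (Suc s))"
      unfolding atLeast0AtMost lessThan_Suc_atMost[symmetric]
      by (subst sum.lessThan_Suc_shift) simp
    also have "\<dots> = (\<Sum>s<n. - B s)"
    proof (rule sum.cong)
      fix s assume "s \<in> {..<n}"
      then have s: "s < n" by simp
      have e: "Suc s * n + t (Suc s) = Suc s * Suc n + t s" by (simp add: t_Suc)
      show "(-1)^Suc s * fps_X ^ (Suc s * n + t (Suc s)) * (1 - fps_X^Suc s) * P (Suc s) = - B s"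
        unfolding B_def P_Suc[OF s] e by (simp only: power_Suc mult.assoc mult_minus_left mult_1)
    qed simp
    finally show ?thesis by (simp add: sum_negf)
  qed
  also have "(\<Sum>s=0..n. B s) = (\<Sum>s<n. B s) + B n"
    by (simp add: atLeast0AtMost lessThan_Suc_atMost[symmetric])
  \<comment> \<open>With \<open>s = n + 1\<close>, \<open>- B n\<close> and the term split off at
    the start are the two pentagonal terms of index \<open>s\<close>.\<close>
  also have "B n = (-1)^n * fps_X ^ (Suc n * Suc n + t n)"
    by (simp add: B_def P_def)
  finally show ?case
    using Suc.IH by (simp add: P_def t_def algebra_simps)
qed simp

lemma square_coprime_6:
  fixes x :: int
  assumes "24 * n + 1 = x\<^sup>2"
  shows "x mod 6 = 1 \<or> x mod 6 = 5"
proof -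
  have "x mod 6 \<in> {0, 1, 2, 3, 4, 5}"
    using pos_mod_bound[of 6 x] pos_mod_sign[of 6 x] by force
  moreover have "x\<^sup>2 mod 6 = 1" unfolding assms[symmetric] by presburger
  then have "(x mod 6)\<^sup>2 mod 6 = 1" by (simp add: power_mod)
  ultimately show ?thesis by auto
qed

text \<open>The pentagonal exponents \<open>e = s(3s - 1)/2\<close> and
  \<open>e = s(3s + 1)/2\<close> are those for which \<open>24e + 1\<close> is the square of
  \<open>6s - 1\<close> or \<open>6s + 1\<close>. The signs disappear in characteristic 2.\<close>

lemma euler_fps_1_nth:
  "fps_nth (euler_fps 1 :: bit fps) N = of_bool (\<exists>x::int. 24 * int N + 1 = x\<^sup>2)"
proof -
  define b where "b e = (of_bool (24 * int N + 1 = e\<^sup>2) :: bit)" for e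
  have m1: "(-1 :: bit fps) = 1" by (rule bit_fps_uminus)
  have e1: "24 * int (s * s + s * (s - 1) div 2) + 1 = (6 * int s - 1)\<^sup>2" if "s \<ge> 1" for s
  proof -
    have "2 * (s * (s - 1) div 2) = s * (s - 1)" by (cases "even s") auto
    then have "2 * int (s * (s - 1) div 2) = int s * (int s - 1)"
      using that by (metis int_ops(6) of_nat_1 of_nat_diff of_nat_mult of_nat_numeral)
    then show ?thesis by (simp add: power2_eq_square algebra_simps)
  qed
  have e2: "24 * int (s * s + s * (s + 1) div 2) + 1 = (6 * int s + 1)\<^sup>2" for s
  proof -
    have "2 * (s * (s + 1) div 2) = s * (s + 1)" by (cases "even s") auto
    then have "2 * int (s * (s + 1) div 2) = int s * (int s + 1)"
      by (metis of_nat_1 of_nat_add of_nat_mult of_nat_numeral)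
    then show ?thesis by (simp add: power2_eq_square algebra_simps)
  qed
  have gen: "(if N = m then 1 else 0) = b e" if "24 * int m + 1 = e\<^sup>2" for m e
    unfolding b_def that[symmetric] by simp
  note c1 = gen[OF e1] and c2 = gen[OF e2]
  \<comment> \<open>For \<open>s > 0\<close> the exponent exceeds \<open>N\<close>, so only the term
    \<open>s = 0\<close>, the truncated Euler product, reaches the coefficient of
    \<open>q^N\<close>.\<close>
  have "fps_nth (\<Sum>s=0..N. (-1) ^ s * fps_X ^ (s * N + s * (s + 1) div 2) * (\<Prod>j\<in>{s<..N}. 1 - fps_X ^ j) :: bit fps) N
      = (\<Sum>s=0..N. if s = 0 then fps_nth (\<Prod>j\<in>{1..N}. 1 - fps_X ^ j) N else 0)"
    unfolding fps_sum_nth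
  proof (rule sum.cong)
    fix s assume "s \<in> {0..N}"
    have "N < s * N + s * (s + 1) div 2" if "s \<noteq> 0"
    proof -
      have "N * 1 \<le> s * N" using that by (cases s) auto
      moreover have "1 \<le> s * (s + 1) div 2" using that by (cases s) auto
      ultimately show ?thesis by linarith
    qed
    moreover have "{0<..N} = {1..N}" by auto
    ultimately show "fps_nth ((-1) ^ s * fps_X ^ (s * N + s * (s + 1) div 2) * (\<Prod>j\<in>{s<..N}. 1 - fps_X ^ j) :: bit fps) N
        = (if s = 0 then fps_nth (\<Prod>j\<in>{1..N}. 1 - fps_X ^ j) N else 0)"
      by (cases "s = 0") (simp_all add: m1 fps_X_power_mult_nth)
  qed simp
  also have "\<dots> = fps_nth (euler_fps 1) N"
    by (simp add: euler_fps_nth[of "Suc 0" N N])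
  finally have "fps_nth (euler_fps 1 :: bit fps) N = fps_nth (1 + (\<Sum>s=1..N. (-1) ^ s *
      (fps_X ^ (s * s + s * (s - 1) div 2) + fps_X ^ (s * s + s * (s + 1) div 2)))) N"
    unfolding shanks_partial_sum by (rule sym)
  also have "\<dots> = (if N = 0 then 1 else 0) + (\<Sum>s=1..N. b (6 * int s - 1) + b (6 * int s + 1))"
    unfolding fps_add_nth fps_one_nth fps_sum_nth
  proof (intro arg_cong2[of _ _ _ _ "(+)"] sum.cong refl)
    fix s assume "s \<in> {1..N}"
    then have "s \<ge> 1" by simp
    show "fps_nth ((-1) ^ s * (fps_X ^ (s * s + s * (s - 1) div 2) + fps_X ^ (s * s + s * (s + 1) div 2)) :: bit fps) N
        = b (6 * int s - 1) + b (6 * int s + 1)"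
      unfolding c1[OF \<open>s \<ge> 1\<close>, symmetric] c2[symmetric] by (simp add: m1)
  qed
  also have "\<dots> = of_bool (\<exists>x::int. 24 * int N + 1 = x\<^sup>2)"
  proof (cases "N > 0 \<and> (\<exists>x::int. 24 * int N + 1 = x\<^sup>2)")
    case True
    then obtain x :: int where x: "24 * int N + 1 = x\<^sup>2" "x \<ge> 0"
      by (metis abs_ge_zero power2_abs)
    \<comment> \<open>This rounding sends both \<open>6s - 1\<close> and \<open>6s + 1\<close> to
      \<open>s\<close>. It locates the only index that contributes, since the nonnegative root
      \<open>x\<close> is unique.\<close>
    define s where "s = nat ((x + 1) div 6)"
    have xs: "x = 6 * int s - 1 \<or> x = 6 * int s + 1"
    proof -
      have "int s = (x + 1) div 6" using x(2) by (simp add: s_def)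
      with square_coprime_6[OF x(1)] show ?thesis by presburger
    qed
    have "s \<ge> 1" using xs x True by (cases s) (auto simp: power2_eq_square)
    have "s \<le> N"
    proof -
      have "int s \<le> int s * int s" using \<open>s \<ge> 1\<close> by simp
      moreover have "x\<^sup>2 = 36 * (int s * int s) - 12 * int s + 1 \<or> x\<^sup>2 = 36 * (int s * int s) + 12 * int s + 1"
        by (rule disjE[OF xs]; simp only:) (simp_all add: power2_eq_square algebra_simps)
      ultimately show ?thesis using x(1) by linarith
    qed
    have "b (6 * int t - 1) + b (6 * int t + 1) = (if t = s then 1 else 0)" if "t \<ge> 1" for t
    proof -
      have "24 * int N + 1 = e\<^sup>2 \<longleftrightarrow> e = x" if "e \<ge> 0" for e
        using that x by (metis power2_eq_iff_nonneg)
      then have "b (6 * int t - 1) = of_bool (6 * int t - 1 = x)" "b (6 * int t + 1) = of_bool (6 * int t + 1 = x)"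
        using that by (simp_all add: b_def)
      moreover have "\<not> (6 * int t - 1 = x \<and> 6 * int t + 1 = x)" by simp
      moreover have "6 * int t - 1 = x \<or> 6 * int t + 1 = x \<longleftrightarrow> t = s" using xs by presburger
      ultimately show ?thesis by auto
    qed
    then have "(\<Sum>t=1..N. b (6 * int t - 1) + b (6 * int t + 1)) = (\<Sum>t=1..N. if t = s then 1 else 0)"
      by (intro sum.cong) auto
    with \<open>s \<ge> 1\<close> \<open>s \<le> N\<close> True show ?thesis by simp
  next
    case False
    then show ?thesis
      by (cases "N = 0") (auto simp: b_def intro: exI[of _ 1])
  qed
  finally show ?thesis .
qed

section \<open>Products of sparse series as counts of integer points\<close>

lemma bit_fps_mult_nth_image:
  fixes F G :: "bit fps"
  assumes "\<And>i. fps_nth F i = 1 \<longleftrightarrow> i \<in> f ` X" "inj_on f X"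
    and "\<And>k. fps_nth G k = 1 \<longleftrightarrow> k \<in> g ` Y" "inj_on g Y"
  shows "fps_nth (F * G) N = of_bool (odd (card {(x, y). x \<in> X \<and> y \<in> Y \<and> f x + g y = N}))"
proof -
  let ?S = "{(x, y). x \<in> X \<and> y \<in> Y \<and> f x + g y = N}"
  have inj: "inj_on (map_prod f g) ?S"
    by (rule inj_on_subset[OF map_prod_inj_on[OF assms(2,4)]]) auto
  have "map_prod f g ` ?S = {(i, k). i + k = N \<and> i \<in> f ` X \<and> k \<in> g ` Y}" (is "_ = ?R")
  proof (intro equalityI subsetI)
    fix z assume "z \<in> ?R"
    then obtain x y where "z = (f x, g y)" "x \<in> X" "y \<in> Y" "f x + g y = N" by blast
    then show "z \<in> map_prod f g ` ?S" by (intro image_eqI[of _ _ "(x, y)"]) auto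
  qed auto
  with card_image[OF inj] have "card ?R = card ?S" by simp
  then show ?thesis
    unfolding bit_fps_mult_nth assms(1,3) by simp
qed

text \<open>The generalized pentagonal number \<open>n\<close> with \<open>24n + 1 = x^2\<close>;
  likewise \<open>tri_index\<close> gives the triangular number \<open>n\<close> with
  \<open>8n + 1 = x^2\<close>. They are used on the residue class 5 modulo 6 and on the positive odd
  integers, which contain exactly one of \<open>x\<close> and \<open>- x\<close> for each admissible
  root.\<close>

definition pent_index :: "int \<Rightarrow> nat" where
  "pent_index x = nat ((x\<^sup>2 - 1) div 24)"

definition tri_index :: "int \<Rightarrow> nat" where
  "tri_index x = nat ((x\<^sup>2 - 1) div 8)"

lemma pent_index:
  assumes "x mod 6 = 5"
  shows "x\<^sup>2 = 24 * int (pent_index x) + 1"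
proof -
  obtain k where k: "x = 6 * k + 5"
    using assms by (metis mult_div_mod_eq)
  have "even (k * (3 * k + 5))" by auto
  then obtain m where m: "k * (3 * k + 5) = 2 * m" by (elim evenE)
  have "x\<^sup>2 = 12 * (k * (3 * k + 5)) + 25" by (simp add: k power2_eq_square algebra_simps)
  also have "\<dots> = 24 * (m + 1) + 1" by (simp add: m)
  finally have *: "x\<^sup>2 = 24 * (m + 1) + 1" .
  then have "24 * (m + 1) + 1 \<ge> 0" by (metis zero_le_power2)
  then have "m + 1 \<ge> 0" by presburger
  with * show ?thesis by (simp add: pent_index_def)
qed

lemma tri_index:
  assumes "odd x"
  shows "x\<^sup>2 = 8 * int (tri_index x) + 1"
proof -
  obtain k where k: "x = 2 * k + 1" using assms by (elim oddE)
  have "even (k * (k + 1))" by auto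
  then obtain m where m: "k * (k + 1) = 2 * m" by (elim evenE)
  have "x\<^sup>2 = 4 * (k * (k + 1)) + 1" by (simp add: k power2_eq_square algebra_simps)
  also have "\<dots> = 8 * m + 1" by (simp add: m)
  finally have *: "x\<^sup>2 = 8 * m + 1" .
  then have "8 * m + 1 \<ge> 0" by (metis zero_le_power2)
  then have "m \<ge> 0" by presburger
  with * show ?thesis by (simp add: tri_index_def)
qed

lemma inj_on_pent_index: "inj_on pent_index {x. x mod 6 = 5}"
proof (rule inj_onI, clarify)
  fix x y :: int
  assume xy: "x mod 6 = 5" "y mod 6 = 5" "pent_index x = pent_index y"
  then have "x\<^sup>2 = y\<^sup>2" using pent_index[of x] pent_index[of y] by simp
  then have "x = y \<or> x = - y" by (rule power2_eq_iff[THEN iffD1])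
  then show "x = y" using xy(1,2) by presburger
qed

lemma inj_on_tri_index: "inj_on tri_index {x. odd x \<and> x > 0}"
proof (rule inj_onI, clarify)
  fix x y :: int
  assume xy: "odd x" "x > 0" "odd y" "y > 0" "tri_index x = tri_index y"
  then have "x\<^sup>2 = y\<^sup>2" using tri_index[of x] tri_index[of y] by simp
  then show "x = y" using xy by (simp add: power2_eq_iff_nonneg)
qed

lemma pent_index_image: "n \<in> pent_index ` {x. x mod 6 = 5} \<longleftrightarrow> (\<exists>x. 24 * int n + 1 = x\<^sup>2)"
proof
  assume "n \<in> pent_index ` {x. x mod 6 = 5}"
  then obtain x where "n = pent_index x" "x mod 6 = 5" by auto
  then show "\<exists>x. 24 * int n + 1 = x\<^sup>2" using pent_index[of x] by (intro exI[of _ x]) simp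
next
  assume "\<exists>x. 24 * int n + 1 = x\<^sup>2"
  then obtain x where x: "24 * int n + 1 = x\<^sup>2" by blast
  obtain y where y: "24 * int n + 1 = y\<^sup>2" "y mod 6 = 5"
  proof (cases "x mod 6 = 5")
    case False
    with square_coprime_6[OF x] have "(- x) mod 6 = 5" by presburger
    with x that[of "- x"] show ?thesis by simp
  qed (use x that in blast)
  with pent_index[of y] show "n \<in> pent_index ` {x. x mod 6 = 5}" by (intro image_eqI[of _ _ y]) auto
qed

lemma tri_index_image: "n \<in> tri_index ` {x. odd x \<and> x > 0} \<longleftrightarrow> (\<exists>x. 8 * int n + 1 = x\<^sup>2)"
proof
  assume "n \<in> tri_index ` {x. odd x \<and> x > 0}"
  then obtain x where "n = tri_index x" "odd x" by auto
  then show "\<exists>x. 8 * int n + 1 = x\<^sup>2" using tri_index[of x] by (intro exI[of _ x]) simp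
next
  assume "\<exists>x. 8 * int n + 1 = x\<^sup>2"
  then obtain x where x: "8 * int n + 1 = x\<^sup>2" by blast
  then have "odd (x\<^sup>2)" by (simp flip: x)
  then have "odd \<bar>x\<bar>" by simp
  then have "odd \<bar>x\<bar> \<and> \<bar>x\<bar> > 0" by auto
  with x tri_index[of "\<bar>x\<bar>"] show "n \<in> tri_index ` {x. odd x \<and> x > 0}"
    by (intro image_eqI[of _ _ "\<bar>x\<bar>"]) auto
qed

section \<open>The cube of Euler's product as the series of triangular numbers\<close>

text \<open>\<open>8n + 1\<close> is a square exactly when \<open>n\<close> is triangular, so this
  is the sum of \<open>q^(m(m+1)/2)\<close> over \<open>m \<ge> 0\<close>.\<close>

definition tri_fps :: "bit fps" where
  "tri_fps = Abs_fps (\<lambda>n. of_bool (\<exists>x::int. 8 * int n + 1 = x\<^sup>2))"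

lemma finite_int_form_solutions:
  fixes a b M :: int
  assumes "a > 0" "b > 0"
  shows "finite {(x, y). a * x\<^sup>2 + b * y\<^sup>2 = M}"
proof (rule finite_subset)
  show "{(x, y). a * x\<^sup>2 + b * y\<^sup>2 = M} \<subseteq> {-M..M} \<times> {-M..M}"
  proof (rule subrelI)
    fix x y assume "(x, y) \<in> {(x, y). a * x\<^sup>2 + b * y\<^sup>2 = M}"
    then have M: "a * x\<^sup>2 + b * y\<^sup>2 = M" by simp
    have le: "\<bar>z\<bar> \<le> c * z\<^sup>2" if "c > 0" for c z :: int
    proof -
      have "\<bar>z\<bar> * 1 \<le> \<bar>z\<bar> * \<bar>z\<bar>" using mult_left_mono[of 1 "\<bar>z\<bar>" "\<bar>z\<bar>"] by (cases "z = 0") auto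
      also have "\<dots> = 1 * z\<^sup>2" by (simp add: power2_eq_square)
      also have "\<dots> \<le> c * z\<^sup>2" using that by (intro mult_right_mono) auto
      finally show ?thesis by simp
    qed
    have "0 \<le> a * x\<^sup>2" "0 \<le> b * y\<^sup>2" using assms by auto
    with le[OF assms(1), of x] le[OF assms(2), of y] M have "\<bar>x\<bar> \<le> M" "\<bar>y\<bar> \<le> M"
      by linarith+
    then show "(x, y) \<in> {-M..M} \<times> {-M..M}" by (simp add: abs_le_iff)
  qed
qed simp

text \<open>\<open>S N\<close> indexes the contributions to the coefficient of \<open>q^N\<close> in
  \<open>tri_fps * euler_fps 1\<close>. An involution that preserves the form
  \<open>3x^2 + y^2\<close> pairs off all of them except those with
  \<open>x = \<bar>y\<bar>\<close>.\<close>

lemma even_card_tri_pent: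
  defines "S N \<equiv> {(x::int, y). odd x \<and> x > 0 \<and> y mod 6 = 5 \<and> 3 * x\<^sup>2 + y\<^sup>2 = 24 * int N + 4}"
  shows "odd (card (S N)) \<longleftrightarrow> (\<exists>y::int. y mod 6 = 5 \<and> y\<^sup>2 = 6 * int N + 1)"
proof -
  \<comment> \<open>Up to signs, $f$ multiplies $(y + x\sqrt{-3})/2$ by whichever primitive cube root of unity
    keeps the result outside $\mathbb{Z}[\sqrt{-3}]$.\<close>
  define f :: "int \<times> int \<Rightarrow> int \<times> int" where
    "f = (\<lambda>(x, y). if odd ((x + y) div 2) then (\<bar>(x + y) div 2\<bar>, (3 * x - y) div 2)
      else (\<bar>(x - y) div 2\<bar>, (- 3 * x - y) div 2))"
  have f_odd: "f (x, y) = (\<bar>(x + y) div 2\<bar>, (3 * x - y) div 2)" if "odd ((x + y) div 2)" for x y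
    unfolding f_def case_prod_conv by (rule if_P[OF that])
  have f_even: "f (x, y) = (\<bar>(x - y) div 2\<bar>, (- 3 * x - y) div 2)" if "even ((x + y) div 2)" for x y
    unfolding f_def case_prod_conv by (rule if_not_P) (use that in blast)
  have fS: "f z \<in> S N \<and> f (f z) = z" if "z \<in> S N" for z
  proof -
    obtain x y where z: "z = (x, y)" by force
    with that have xy: "odd x" "x > 0" "y mod 6 = 5" "3 * x\<^sup>2 + y\<^sup>2 = 24 * int N + 4"
      by (auto simp: S_def)
    have "even (x + y)" using xy(1,3) by presburger
    then obtain p where p: "x + y = 2 * p" by (elim evenE)
    then have y: "y = 2 * p - x" by simp
    have d: "(x + y) div 2 = p" "(3 * x - y) div 2 = 2 * x - p" "(x - y) div 2 = x - p"
        "(- 3 * x - y) div 2 = - x - p"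
      unfolding y by presburger+
    show ?thesis
    proof (cases "odd p")
      case True
      have fz: "f z = (\<bar>p\<bar>, 2 * x - p)" using f_odd[of x y] True unfolding z d .
      have "\<bar>p\<bar> > 0" using True by auto
      moreover have "(2 * x - p) mod 6 = 5" using True xy(1,3) unfolding y by presburger
      moreover have "3 * \<bar>p\<bar>\<^sup>2 + (2 * x - p)\<^sup>2 = 24 * int N + 4"
        using xy(4) unfolding y by (simp add: power2_eq_square algebra_simps)
      ultimately have "f z \<in> S N" using True by (simp add: fz S_def)
      moreover have "f (f z) = z"
      \<comment> \<open>Taking the absolute value may change the sign of the first coordinate; that
        sign decides which branch of \<open>f\<close> applies the second time.\<close>
      proof (cases "p > 0")
        case p: True
        have e: "(p + (2 * x - p)) div 2 = x" "(3 * p - (2 * x - p)) div 2 = y"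
          unfolding y by presburger+
        show ?thesis
          using f_odd[of p "2 * x - p"] xy(1,2) unfolding fz unfolding z e abs_of_pos[OF p] by simp
      next
        case p: False
        have e: "(- p + (2 * x - p)) div 2 = x - p" "(- p - (2 * x - p)) div 2 = - x"
            "(- 3 * - p - (2 * x - p)) div 2 = y"
          unfolding y by presburger+
        have "\<bar>p\<bar> = - p" using p by simp
        then show ?thesis
          using f_even[of "- p" "2 * x - p"] xy(1,2) True unfolding fz unfolding z e by simp
      qed
      ultimately show ?thesis by blast
    next
      case False
      have fz: "f z = (\<bar>x - p\<bar>, - x - p)" using f_even[of x y] False unfolding z d by blast
      have "odd (x - p)" using False xy(1) by simp
      moreover from this have "\<bar>x - p\<bar> > 0" by auto
      moreover have "(- x - p) mod 6 = 5" using False xy(1,3) unfolding y by presburger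
      moreover have "3 * \<bar>x - p\<bar>\<^sup>2 + (- x - p)\<^sup>2 = 24 * int N + 4"
        using xy(4) unfolding y by (simp add: power2_eq_square algebra_simps)
      ultimately have "f z \<in> S N" by (simp add: fz S_def)
      moreover have "f (f z) = z"
      proof (cases "x - p > 0")
        case p: True
        have e: "(x - p + (- x - p)) div 2 = - p" "(x - p - (- x - p)) div 2 = x"
            "(- 3 * (x - p) - (- x - p)) div 2 = y"
          unfolding y by presburger+
        show ?thesis
          using f_even[of "x - p" "- x - p"] xy(1,2) False unfolding fz unfolding z e abs_of_pos[OF p] by simp
      next
        case p: False
        have e: "(p - x + (- x - p)) div 2 = - x" "(3 * (p - x) - (- x - p)) div 2 = y"
          unfolding y by presburger+
        have "\<bar>x - p\<bar> = p - x" using p by simp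
        then show ?thesis
          using f_odd[of "p - x" "- x - p"] xy(1,2) unfolding fz unfolding z e by simp
      qed
      ultimately show ?thesis by blast
    qed
  qed
  have "finite (S N)"
    by (rule finite_subset[OF _ finite_int_form_solutions[of 3 1 "24 * int N + 4"]]) (auto simp: S_def)
  then have "even (card (S N)) \<longleftrightarrow> even (card {z \<in> S N. f z = z})"
    using fS by (intro card_involution_cong) auto
  \<comment> \<open>At a fixed point \<open>x = \<bar>y\<bar>\<close>, and the equation becomes
    \<open>4y^2 = 24N + 4\<close>.\<close>
  also have "{z \<in> S N. f z = z} = (\<lambda>y. (\<bar>y\<bar>, y)) ` {y. y mod 6 = 5 \<and> y\<^sup>2 = 6 * int N + 1}"
  proof (intro set_eqI iffI)
    fix z assume "z \<in> {z \<in> S N. f z = z}"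
    then obtain x y where z: "z = (x, y)" and xy: "x > 0" "y mod 6 = 5" "3 * x\<^sup>2 + y\<^sup>2 = 24 * int N + 4" "f (x, y) = (x, y)"
      by (auto simp: S_def)
    have "odd x" using \<open>z \<in> {z \<in> S N. f z = z}\<close> z by (simp add: S_def)
    have "x = \<bar>y\<bar>"
    proof (cases "odd ((x + y) div 2)")
      case True
      then have "(3 * x - y) div 2 = y" using f_odd xy(4) by simp
      then have "x = y" using \<open>odd x\<close> xy(2) by presburger
      then show ?thesis using xy(1) by simp
    next
      case False
      then have "(- 3 * x - y) div 2 = y" using f_even[of x y] xy(4) by (metis prod.inject)
      then have "x = - y" using \<open>odd x\<close> xy(2) by presburger
      then show ?thesis using xy(1) by simp
    qed
    with xy z show "z \<in> (\<lambda>y. (\<bar>y\<bar>, y)) ` {y. y mod 6 = 5 \<and> y\<^sup>2 = 6 * int N + 1}" by auto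
  next
    fix z assume "z \<in> (\<lambda>y. (\<bar>y\<bar>, y)) ` {y. y mod 6 = 5 \<and> y\<^sup>2 = 6 * int N + 1}"
    then obtain y where z: "z = (\<bar>y\<bar>, y)" and y: "y mod 6 = 5" "y\<^sup>2 = 6 * int N + 1" by auto
    have "\<bar>y\<bar> > 0" "odd y" using y(1) by presburger+
    moreover have "f (\<bar>y\<bar>, y) = (\<bar>y\<bar>, y)"
    proof (cases "y > 0")
      case True
      have "(y + y) div 2 = y" "(3 * y - y) div 2 = y" by presburger+
      with True f_odd[of y y] \<open>odd y\<close> show ?thesis by simp
    next
      case False
      have "(- y + y) div 2 = 0" "(- y - y) div 2 = - y" "(- 3 * - y - y) div 2 = y" by presburger+
      with False f_even[of "- y" y] show ?thesis by simp
    qed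
    ultimately show "z \<in> {z \<in> S N. f z = z}" using y z by (simp add: S_def)
  qed
  also have "card \<dots> = card {y::int. y mod 6 = 5 \<and> y\<^sup>2 = 6 * int N + 1}"
    by (intro card_image inj_onI) auto
  also have "\<dots> = of_bool (\<exists>y::int. y mod 6 = 5 \<and> y\<^sup>2 = 6 * int N + 1)"
  proof (cases "\<exists>y::int. y mod 6 = 5 \<and> y\<^sup>2 = 6 * int N + 1")
    case True
    then obtain y :: int where y: "y mod 6 = 5" "y\<^sup>2 = 6 * int N + 1" by blast
    have "{y. y mod 6 = 5 \<and> y\<^sup>2 = 6 * int N + 1} = {y}"
    proof (intro equalityI subsetI)
      fix w assume "w \<in> {y. y mod 6 = 5 \<and> y\<^sup>2 = 6 * int N + 1}"
      then have "w mod 6 = 5" "w\<^sup>2 = y\<^sup>2" using y by auto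
      then have "w = y \<or> w = - y" by (simp add: power2_eq_iff)
      with \<open>w mod 6 = 5\<close> y(1) have "w = y" by presburger
      then show "w \<in> {y}" by simp
    qed (use y in auto)
    with True show ?thesis by simp
  next
    case False
    then have e: "{y::int. y mod 6 = 5 \<and> y\<^sup>2 = 6 * int N + 1} = {}" by blast
    show ?thesis unfolding e using False by simp
  qed
  finally show ?thesis by simp
qed

text \<open>Jacobi's identity modulo 2. Multiplied by Euler's product, its right-hand side has a
  form whose coefficients can be counted, while the left-hand side becomes a fourth power, that is,
  Euler's product in \<open>q^4\<close>.\<close>

lemma euler_fps_cube: "(euler_fps 1 :: bit fps) ^ 3 = tri_fps"
proof -
  let ?P = "euler_fps 1 :: bit fps"
  have "tri_fps * ?P = ?P ^ 4"
  proof (rule fps_ext)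
    fix N
    have "{(x, y). x \<in> {x. odd x \<and> x > 0} \<and> y \<in> {x. x mod 6 = 5} \<and> tri_index x + pent_index y = N}
      = {(x, y). odd x \<and> x > 0 \<and> y mod 6 = 5 \<and> 3 * x\<^sup>2 + y\<^sup>2 = 24 * int N + 4}"
    proof -
      have "tri_index x + pent_index y = N \<longleftrightarrow> 3 * x\<^sup>2 + y\<^sup>2 = 24 * int N + 4"
        if "odd x" "y mod 6 = 5" for x y
        using tri_index[OF that(1)] pent_index[OF that(2)] by linarith
      then show ?thesis by auto
    qed
    then have "fps_nth (tri_fps * ?P) N = of_bool (\<exists>y::int. y mod 6 = 5 \<and> y\<^sup>2 = 6 * int N + 1)"
      by (subst bit_fps_mult_nth_image[OF _ inj_on_tri_index _ inj_on_pent_index])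
        (simp_all only: tri_index_image pent_index_image euler_fps_1_nth even_card_tri_pent tri_fps_def
          fps_nth_Abs_fps of_bool_eq_1_iff)
    \<comment> \<open>As \<open>y\<close> is prime to 6, \<open>y^2\<close> is 1 modulo 24, which
      forces 4 to divide \<open>N\<close>.\<close>
    also have "(\<exists>y::int. y mod 6 = 5 \<and> y\<^sup>2 = 6 * int N + 1) \<longleftrightarrow>
        4 dvd N \<and> N div 4 \<in> pent_index ` {x. x mod 6 = 5}"
    proof
      assume "\<exists>y::int. y mod 6 = 5 \<and> y\<^sup>2 = 6 * int N + 1"
      then obtain y :: int where y: "y mod 6 = 5" "y\<^sup>2 = 6 * int N + 1" by blast
      with pent_index[OF y(1)] have "N = 4 * pent_index y" by linarith
      with y(1) show "4 dvd N \<and> N div 4 \<in> pent_index ` {x. x mod 6 = 5}" by simp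
    next
      assume "4 dvd N \<and> N div 4 \<in> pent_index ` {x. x mod 6 = 5}"
      then obtain y where "N = 4 * pent_index y" "y mod 6 = 5" by auto
      with pent_index[of y] show "\<exists>y::int. y mod 6 = 5 \<and> y\<^sup>2 = 6 * int N + 1" by (intro exI[of _ y]) auto
    qed
    also have "of_bool \<dots> = fps_nth (?P ^ 4) N"
    proof -
      have P4: "?P ^ 4 = (?P\<^sup>2)\<^sup>2" by (simp flip: power_mult)
      have "4 dvd N \<longleftrightarrow> even N \<and> even (N div 2)" by presburger
      moreover have "N div 2 div 2 = N div 4" by presburger
      ultimately show ?thesis
        unfolding P4 bit_fps_square_nth by (simp add: pent_index_image euler_fps_1_nth[simplified])
    qed
    finally show "fps_nth (tri_fps * ?P) N = fps_nth (?P ^ 4) N" .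
  qed
  also have "?P ^ 4 = ?P ^ 3 * ?P" by (simp add: eval_nat_numeral)
  finally have "tri_fps * ?P = ?P ^ 3 * ?P" .
  moreover have "?P \<noteq> 0" using euler_fps_nth_0[of 1, where ?'a = bit] by auto
  ultimately show ?thesis by simp
qed

section \<open>Parity of the number of solutions of u^2 + 5v^2 = M\<close>

text \<open>The congruence selects one of the two signs $\pm(u, v)$, and only those solutions for which
  $u - 5v$ and $u + v$ are prime to 3.\<close>

definition form5_set :: "int \<Rightarrow> (int \<times> int) set" where
  "form5_set M = {(u, v). (u + v) mod 3 = 2 \<and> u\<^sup>2 + 5 * v\<^sup>2 = M}"

lemma finite_form5_set: "finite (form5_set M)"
  by (rule finite_subset[OF _ finite_int_form_solutions[of 1 5 M]]) (auto simp: form5_set_def)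

text \<open>A root \<open>x\<close> is prime to 3 because \<open>M\<close> is, so the congruence
  admits exactly one of \<open>x\<close> and \<open>- x\<close>.\<close>

lemma card_square_solutions:
  fixes c M :: int
  assumes "c > 0" "\<not> 3 dvd M"
  shows "card {x. x mod 3 = 2 \<and> c * x\<^sup>2 = M} = of_bool (\<exists>x. M = c * x\<^sup>2)"
proof (cases "\<exists>x. M = c * x\<^sup>2")
  case True
  then obtain x where x: "M = c * x\<^sup>2" by blast
  with assms have "\<not> 3 dvd x" by (metis dvd_mult dvd_power pos2 dvd_trans)
  then have "x mod 3 = 2 \<or> (- x) mod 3 = 2" by presburger
  then obtain y where y: "y mod 3 = 2" "M = c * y\<^sup>2" using x by (metis power2_minus)
  have "{x. x mod 3 = 2 \<and> c * x\<^sup>2 = M} = {y}"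
  proof (intro equalityI subsetI)
    fix w assume "w \<in> {x. x mod 3 = 2 \<and> c * x\<^sup>2 = M}"
    then have w: "w mod 3 = 2" "w\<^sup>2 = y\<^sup>2" using y assms by auto
    then have "w = y \<or> w = - y" by (simp add: power2_eq_iff)
    with w(1) y(1) have "w = y" by presburger
    then show "w \<in> {y}" by simp
  qed (use y in auto)
  with True show ?thesis by simp
next
  case False
  then have e: "{x. x mod 3 = 2 \<and> c * x\<^sup>2 = M} = {}" by blast
  show ?thesis unfolding e using False by simp
qed

text \<open>Modulo 3, \<open>M\<close> is \<open>(u - v)(u + v)\<close>, so \<open>u - v\<close> is
  also prime to 3. Hence conjugation, followed by a change of sign where the congruence demands it,
  is an involution. Its fixed points lie on the two axes, where \<open>M\<close> is a square or five
  times a square.\<close>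

lemma odd_card_form5_set_coprime:
  assumes "\<not> 3 dvd M"
  shows "odd (card (form5_set M)) \<longleftrightarrow> (\<exists>x. M = x\<^sup>2) \<noteq> (\<exists>x. M = 5 * x\<^sup>2)"
proof -
  define f :: "int \<times> int \<Rightarrow> int \<times> int" where
    "f = (\<lambda>(u, v). if (u - v) mod 3 = 2 then (u, - v) else (- u, v))"
  have f_in: "f z \<in> form5_set M" and f_f: "f (f z) = z" if zM: "z \<in> form5_set M" for z
  proof -
    obtain u v where z: "z = (u, v)" by force
    with zM have uv: "(u + v) mod 3 = 2" "u\<^sup>2 + 5 * v\<^sup>2 = M"
      by (auto simp: form5_set_def)
    have "M = (u - v) * (u + v) + 3 * (2 * v\<^sup>2)"
      by (simp add: uv(2)[symmetric] power2_eq_square algebra_simps)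
    with assms have "\<not> 3 dvd u - v" by fastforce
    then have alt: "(u - v) mod 3 = 2 \<or> (- u + v) mod 3 = 2" by presburger
    show "f z \<in> form5_set M"
      using alt uv by (auto simp: f_def z form5_set_def)
    show "f (f z) = z"
      using alt uv(1) by (auto simp: f_def z) presburger+
  qed
  have "even (card (form5_set M)) \<longleftrightarrow> even (card {z \<in> form5_set M. f z = z})"
    using f_in f_f by (intro card_involution_cong finite_form5_set) auto
  also have "{z \<in> form5_set M. f z = z} =
      (\<lambda>u. (u, 0)) ` {x. x mod 3 = 2 \<and> 1 * x\<^sup>2 = M} \<union> (\<lambda>v. (0, v)) ` {x. x mod 3 = 2 \<and> 5 * x\<^sup>2 = M}"
    (is "_ = ?A \<union> ?B")
  proof (intro equalityI subsetI)
    fix z assume "z \<in> {z \<in> form5_set M. f z = z}"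
    then obtain u v where z: "z = (u, v)" and uv: "(u + v) mod 3 = 2" "u\<^sup>2 + 5 * v\<^sup>2 = M" "f (u, v) = (u, v)"
      by (auto simp: form5_set_def)
    have "v = 0 \<or> u = 0" using uv(3) by (auto simp: f_def split: if_splits)
    then show "z \<in> ?A \<union> ?B" using uv(1,2) z by auto
  next
    fix z assume "z \<in> ?A \<union> ?B"
    then show "z \<in> {z \<in> form5_set M. f z = z}"
    proof
      assume "z \<in> ?A"
      then show ?thesis by (auto simp: form5_set_def f_def)
    next
      assume "z \<in> ?B"
      then obtain v where v: "z = (0, v)" "v mod 3 = 2" "5 * v\<^sup>2 = M" by auto
      then have "(0 - v) mod 3 \<noteq> 2" by presburger
      with v show ?thesis by (auto simp: form5_set_def f_def)
    qed
  qed
  also have "card (?A \<union> ?B) = card ?A + card ?B"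
  proof (rule card_Un_disjoint)
    have "{z \<in> form5_set M. f z = z} = ?A \<union> ?B" by fact
    then have "finite (?A \<union> ?B)" using finite_form5_set[of M] by (metis finite_Collect_conjI finite_subset Collect_subset)
    then show "finite ?A" "finite ?B" by simp_all
    show "?A \<inter> ?B = {}" by auto
  qed
  also have "card ?A = card {x. x mod 3 = 2 \<and> 1 * x\<^sup>2 = M}"
    by (intro card_image inj_onI) auto
  also have "\<dots> = of_bool (\<exists>x. M = 1 * x\<^sup>2)"
    using assms by (intro card_square_solutions) auto
  also have "card ?B = card {x. x mod 3 = 2 \<and> 5 * x\<^sup>2 = M}"
    by (intro card_image inj_onI) auto
  also have "\<dots> = of_bool (\<exists>x. M = 5 * x\<^sup>2)"
    using assms by (intro card_square_solutions) auto
  finally show ?thesis by (auto simp: of_bool_def split: if_splits)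
qed

text \<open>3 divides \<open>(u - v)(u + v)\<close> but not \<open>u + v\<close>. The coordinate
  \<open>t\<close> makes divisibility by 9 visible: as \<open>v\<close> is prime to 3, 9 divides
  \<open>M\<close> exactly when 3 divides \<open>v + t\<close>.\<close>

lemma form5_set_3_dvd:
  assumes "3 dvd M" "(u, v) \<in> form5_set M"
  obtains t where "u = v + 3 * t" "v mod 3 = 1" "M = 6 * v * (v + t) + 9 * t\<^sup>2"
proof -
  have uv: "(u + v) mod 3 = 2" "u\<^sup>2 + 5 * v\<^sup>2 = M" using assms by (auto simp: form5_set_def)
  have "(u - v) * (u + v) = M - 3 * (2 * v\<^sup>2)"
    by (simp add: uv(2)[symmetric] power2_eq_square algebra_simps)
  then have "3 dvd (u - v) * (u + v)" using assms(1) by simp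
  moreover have "\<not> 3 dvd u + v" using uv(1) by presburger
  moreover have "prime (3::int)" by simp
  ultimately have "3 dvd u - v" by (metis prime_dvd_multD)
  then obtain t where t: "u - v = 3 * t" by (elim dvdE)
  then have u: "u = v + 3 * t" by simp
  have "v mod 3 = 1" using uv(1) unfolding u by presburger
  moreover have "M = 6 * v * (v + t) + 9 * t\<^sup>2"
    unfolding uv(2)[symmetric] u by (simp add: power2_eq_square algebra_simps)
  ultimately show ?thesis using that u by blast
qed

lemma even_card_form5_set_exact_3:
  assumes "3 dvd M" "\<not> 9 dvd M" "odd M"
  shows "even (card (form5_set M))"
proof -
  \<comment> \<open>The prime $\mathfrak p = (3, 1 + \sqrt{-5})$ is not principal, but
    $\mathfrak p^2 = (2 - \sqrt{-5})$. Up to sign, $f$ is the norm-preserving map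
    $\alpha \mapsto (2 - \sqrt{-5})\overline{\alpha}/3$, which conjugates the part of $\alpha$ prime to $\mathfrak p$.\<close>
  define f :: "int \<times> int \<Rightarrow> int \<times> int" where
    "f = (\<lambda>(u, v). let t = (u - v) div 3 in
        if (t + v) mod 3 = 2 then (2 * t - v, - v - t) else (v - 2 * t, v + t))"
  have f_pos: "f (v + 3 * t, v) = (2 * t - v, - v - t)" if "(t + v) mod 3 = 2" for v t
    using that by (simp add: f_def)
  have f_neg: "f (v + 3 * t, v) = (v - 2 * t, v + t)" if "(t + v) mod 3 = 1" for v t
    using that by (simp add: f_def)
  have f_in: "f z \<in> form5_set M" and f_f: "f (f z) = z" and f_nz: "f z \<noteq> z"
    if zM: "z \<in> form5_set M" for z
  proof -
    obtain u v where z: "z = (u, v)" by force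
    obtain t where u: "u = v + 3 * t" and v: "v mod 3 = 1" and M: "M = 6 * v * (v + t) + 9 * t\<^sup>2"
      using form5_set_3_dvd[OF assms(1)] zM unfolding z by metis
    \<comment> \<open>The residue of \<open>v + t\<close> modulo 3 fixes the sign in
      \<open>f\<close>, so that the coordinates of the image again add up to 2 modulo 3.\<close>
    have "\<not> 3 dvd v + t"
    proof
      assume "3 dvd v + t"
      then obtain w where "v + t = 3 * w" by (elim dvdE)
      then have "M = 9 * (2 * v * w + t\<^sup>2)" using M by (simp add: algebra_simps)
      with assms(2) show False by simp
    qed
    then have "(t + v) mod 3 = 2 \<or> (t + v) mod 3 = 1" by presburger
    then consider "(t + v) mod 3 = 2" | "(t + v) mod 3 = 1" by blast
    then have "f z \<in> form5_set M \<and> f (f z) = z \<and> f z \<noteq> z"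
    proof cases
      case 1
      have fz: "f z = (2 * t - v, - v - t)" using f_pos[OF 1] unfolding z u .
      have "(2 * t - v + (- v - t)) mod 3 = 2" using 1 v by presburger
      moreover have "(2 * t - v)\<^sup>2 + 5 * (- v - t)\<^sup>2 = M"
        unfolding M by (simp add: power2_eq_square algebra_simps)
      ultimately have "f z \<in> form5_set M" by (simp add: fz form5_set_def)
      moreover have "(t + (- v - t)) mod 3 = 2" using v by presburger
      from f_pos[OF this] have "f (f z) = z" unfolding fz unfolding z u by (simp add: algebra_simps)
      \<comment> \<open>A fixed point forces \<open>t\<close> to be even, and
        \<open>6v(v + t) + 9t^2\<close> is then even as well, whereas \<open>M\<close> is odd. The
        other case is similar with \<open>t = 0\<close>.\<close>
      moreover have "f z \<noteq> z"
      proof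
        assume "f z = z"
        then have "t = - 2 * v" unfolding fz unfolding z u by simp
        then have "even M" unfolding M by (simp add: power2_eq_square)
        with assms(3) show False by simp
      qed
      ultimately show ?thesis by blast
    next
      case 2
      have fz: "f z = (v - 2 * t, v + t)" using f_neg[OF 2] unfolding z u .
      have "(v - 2 * t + (v + t)) mod 3 = 2" using 2 v by presburger
      moreover have "(v - 2 * t)\<^sup>2 + 5 * (v + t)\<^sup>2 = M"
        unfolding M by (simp add: power2_eq_square algebra_simps)
      ultimately have "f z \<in> form5_set M" by (simp add: fz form5_set_def)
      moreover have "(- t + (v + t)) mod 3 = 1" using v by presburger
      from f_neg[OF this] have "f (f z) = z" unfolding fz unfolding z u by (simp add: algebra_simps)
      moreover have "f z \<noteq> z"
      proof
        assume "f z = z"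
        then have "t = 0" unfolding fz unfolding z u by simp
        then have "even M" unfolding M by simp
        with assms(3) show False by simp
      qed
      ultimately show ?thesis by blast
    qed
    then show "f z \<in> form5_set M" "f (f z) = z" "f z \<noteq> z" by blast+
  qed
  have "even (card (form5_set M)) \<longleftrightarrow> even (card {z \<in> form5_set M. f z = z})"
    using f_in f_f by (intro card_involution_cong finite_form5_set) auto
  also have "{z \<in> form5_set M. f z = z} = {}" using f_nz by blast
  finally show ?thesis by simp
qed

lemma card_form5_set_9: "card (form5_set (9 * M)) = card (form5_set M)"
proof -
  \<comment> \<open>Multiplication by $2 - \sqrt{-5}$, an element of norm 9.\<close>
  define g :: "int \<times> int \<Rightarrow> int \<times> int" where "g = (\<lambda>(u, v). (2 * u + 5 * v, 2 * v - u))"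
  have "inj g" by (auto simp: g_def inj_def)
  moreover have "g ` form5_set M = form5_set (9 * M)"
  proof (intro equalityI subsetI)
    fix z assume "z \<in> g ` form5_set M"
    then obtain u v where z: "z = (2 * u + 5 * v, 2 * v - u)" and uv: "(u + v) mod 3 = 2" "u\<^sup>2 + 5 * v\<^sup>2 = M"
      by (auto simp: g_def form5_set_def)
    have "(2 * u + 5 * v + (2 * v - u)) mod 3 = 2" using uv(1) by presburger
    moreover have "(2 * u + 5 * v)\<^sup>2 + 5 * (2 * v - u)\<^sup>2 = 9 * M"
      unfolding uv(2)[symmetric] by (simp add: power2_eq_square algebra_simps)
    ultimately show "z \<in> form5_set (9 * M)" by (simp add: z form5_set_def)
  next
    fix z assume zM: "z \<in> form5_set (9 * M)"
    obtain u v where z: "z = (u, v)" by force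
    have "3 dvd 9 * M" by simp
    from form5_set_3_dvd[OF this, of u v] zM z obtain t where
      u: "u = v + 3 * t" and v: "v mod 3 = 1" and M: "9 * M = 6 * v * (v + t) + 9 * t\<^sup>2"
      by metis
    \<comment> \<open>Surjectivity: the quotient of \<open>z\<close> by \<open>2 - sqrt(-5)\<close>
      is integral because 3 divides \<open>v + t\<close>; it is \<open>(2w - v, w)\<close> with
      \<open>w = (v + t)/3\<close>.\<close>
    have "2 * (v * (v + t)) = 3 * (M - t\<^sup>2)" using M by (simp add: algebra_simps)
    then have "3 dvd v * (v + t)" by presburger
    moreover have "\<not> 3 dvd v" using v by presburger
    moreover have "prime (3::int)" by simp
    ultimately have "3 dvd v + t" by (metis prime_dvd_multD)
    then obtain w where w: "v + t = 3 * w" by (elim dvdE)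
    then have t: "t = 3 * w - v" by simp
    have "(2 * w - v + w) mod 3 = 2" using v by presburger
    moreover have "(2 * w - v)\<^sup>2 + 5 * w\<^sup>2 = M"
      using M unfolding t by (simp add: power2_eq_square algebra_simps)
    ultimately have "(2 * w - v, w) \<in> form5_set M" by (simp add: form5_set_def)
    moreover have "z = g (2 * w - v, w)" by (simp add: g_def z u t)
    ultimately show "z \<in> g ` form5_set M" by blast
  qed
  ultimately show ?thesis by (metis card_image inj_on_subset subset_UNIV)
qed

lemma ex_square_multiple_9:
  fixes c M :: int
  assumes "\<not> 3 dvd c"
  shows "(\<exists>x. 9 * M = c * x\<^sup>2) \<longleftrightarrow> (\<exists>x. M = c * x\<^sup>2)"
proof
  assume "\<exists>x. 9 * M = c * x\<^sup>2"
  then obtain x where x: "9 * M = c * x\<^sup>2" by blast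
  have "3 dvd c * x\<^sup>2" unfolding x[symmetric] by simp
  moreover have "prime (3::int)" by simp
  ultimately have "3 dvd x" using assms by (metis prime_dvd_multD prime_dvd_power)
  then obtain y where "x = 3 * y" by (elim dvdE)
  with x show "\<exists>x. M = c * x\<^sup>2" by (intro exI[of _ y]) (simp add: power2_eq_square)
next
  assume "\<exists>x. M = c * x\<^sup>2"
  then obtain x where "M = c * x\<^sup>2" by blast
  then show "\<exists>x. 9 * M = c * x\<^sup>2" by (intro exI[of _ "3 * x"]) (simp add: power2_eq_square)
qed

text \<open>Induction on $M$: the solutions descend from $M$ to $M/9$ whenever 9 divides $M$.\<close>

lemma odd_card_form5_set:
  assumes "odd M" "M > 0"
  shows "odd (card (form5_set M)) \<longleftrightarrow> (\<exists>x. M = x\<^sup>2) \<noteq> (\<exists>x. M = 5 * x\<^sup>2)"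
  using assms
proof (induction "nat M" arbitrary: M rule: less_induct)
  case less
  consider "\<not> 3 dvd M" | "9 dvd M" | "3 dvd M" "\<not> 9 dvd M" by blast
  then show ?case
  proof cases
    case 1
    then show ?thesis by (rule odd_card_form5_set_coprime)
  next
    case 2
    then obtain K where K: "M = 9 * K" by (elim dvdE)
    have "odd K" "K > 0" "nat K < nat M" using less.prems K by auto
    then have "odd (card (form5_set K)) \<longleftrightarrow> (\<exists>x. K = x\<^sup>2) \<noteq> (\<exists>x. K = 5 * x\<^sup>2)"
      using less.hyps by blast
    then show ?thesis
      using ex_square_multiple_9[of 1 K] ex_square_multiple_9[of 5 K]
      unfolding K card_form5_set_9 by simp
  next
    case 3
    \<comment> \<open>If 3 divides \<open>c * x^2\<close> but not \<open>c\<close>, then so does 9.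
      Hence \<open>M\<close> is neither a square nor five times a square, in accordance with the
      even count.\<close>
    have "M \<noteq> c * x\<^sup>2" if "\<not> 3 dvd c" for c x
    proof
      assume M: "M = c * x\<^sup>2"
      have "prime (3::int)" by simp
      with M 3(1) that have "3 dvd x" by (metis prime_dvd_multD prime_dvd_power)
      then obtain y where "x = 3 * y" by (elim dvdE)
      with M have "M = 9 * (c * y\<^sup>2)" by (simp add: power2_eq_square)
      with 3(2) show False by simp
    qed
    from this[of 1] this[of 5] even_card_form5_set_exact_3[OF 3 less.prems(1)] show ?thesis by simp
  qed
qed

section \<open>The 2-dissection of the product of \<open>euler_fps 1\<close> and
  \<open>euler_fps 5\<close>\<close>

lemma euler_fps_5_nth:
  "fps_nth (euler_fps 5 :: bit fps) n = 1 \<longleftrightarrow> n \<in> (\<lambda>y. 5 * pent_index y) ` {y. y mod 6 = 5}"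
proof -
  have "fps_nth (euler_fps 5 :: bit fps) n = 1 \<longleftrightarrow> 5 dvd n \<and> n div 5 \<in> pent_index ` {y. y mod 6 = 5}"
    by (simp add: euler_fps_compose[of 5] fps_nth_compose_X_power pent_index_image euler_fps_1_nth[simplified])
  also have "\<dots> \<longleftrightarrow> n \<in> (\<lambda>y. 5 * pent_index y) ` {y. y mod 6 = 5}"
    by auto
  finally show ?thesis .
qed

text \<open>The map \<open>?h\<close> is multiplication of \<open>u + v sqrt(-5)\<close> by
  \<open>1 + sqrt(-5)\<close>, of norm 6. It identifies \<open>form5_set (4 * int N + 1)\<close>
  with the pairs of pentagonal roots counted by the coefficient.\<close>

lemma euler_fps_1_5_nth:
  "fps_nth (euler_fps 1 * euler_fps 5 :: bit fps) N =
    of_bool ((\<exists>x::int. 4 * int N + 1 = x\<^sup>2) \<noteq> (\<exists>x. 4 * int N + 1 = 5 * x\<^sup>2))"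
proof -
  let ?X = "{x::int. x mod 6 = 5}"
  let ?S = "{(x, y). x \<in> ?X \<and> y \<in> ?X \<and> pent_index x + 5 * pent_index y = N}"
  let ?h = "\<lambda>(u, v). (u - 5 * v, u + v) :: int \<times> int"
  have S: "(x, y) \<in> ?S \<longleftrightarrow> x mod 6 = 5 \<and> y mod 6 = 5 \<and> x\<^sup>2 + 5 * y\<^sup>2 = 24 * int N + 6" for x y
  proof (cases "x mod 6 = 5 \<and> y mod 6 = 5")
    case True
    then have "pent_index x + 5 * pent_index y = N \<longleftrightarrow> x\<^sup>2 + 5 * y\<^sup>2 = 24 * int N + 6"
      using pent_index[of x] pent_index[of y] by linarith
    with True show ?thesis by simp
  qed auto
  have "inj_on (\<lambda>y. 5 * pent_index y) ?X"
    using inj_on_pent_index by (auto simp: inj_on_def)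
  then have "fps_nth (euler_fps 1 * euler_fps 5 :: bit fps) N = of_bool (odd (card ?S))"
    by (intro bit_fps_mult_nth_image inj_on_pent_index euler_fps_5_nth)
      (simp_all only: pent_index_image euler_fps_1_nth of_bool_eq_1_iff)
  also have "card ?S = card (?h ` form5_set (4 * int N + 1))"
  proof (rule arg_cong[of _ _ card], intro equalityI subsetI)
    fix z assume "z \<in> ?S"
    then obtain x y where z: "z = (x, y)" and xy: "x mod 6 = 5" "y mod 6 = 5" "x\<^sup>2 + 5 * y\<^sup>2 = 24 * int N + 6"
      using S by (cases z) blast
    \<comment> \<open>The congruence between \<open>x\<close> and \<open>y\<close> makes the
      quotient by \<open>1 + sqrt(-5)\<close> integral, with \<open>v = (y - x)/6\<close> and
      \<open>u = y - v\<close>.\<close>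
    have "6 dvd y - x" using xy(1,2) by presburger
    then obtain v where "y - x = 6 * v" by (elim dvdE)
    then have x: "x = y - 6 * v" by simp
    have "(y - v)\<^sup>2 + 5 * v\<^sup>2 = 4 * int N + 1"
      using xy(3) unfolding x by (simp add: power2_eq_square algebra_simps)
    moreover have "(y - v + v) mod 3 = 2" using xy(2) by presburger
    ultimately have "(y - v, v) \<in> form5_set (4 * int N + 1)" by (simp add: form5_set_def)
    moreover have "z = ?h (y - v, v)" by (simp add: z x)
    ultimately show "z \<in> ?h ` form5_set (4 * int N + 1)" by blast
  next
    fix z assume "z \<in> ?h ` form5_set (4 * int N + 1)"
    then obtain u v where z: "z = (u - 5 * v, u + v)" and uv: "(u + v) mod 3 = 2" "u\<^sup>2 + 5 * v\<^sup>2 = 4 * int N + 1"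
      by (auto simp: form5_set_def)
    \<comment> \<open>Parity supplements the condition modulo 3 to one modulo 6; the two coordinates
      of the image agree modulo 6.\<close>
    have "odd (u\<^sup>2 + 5 * v\<^sup>2)" unfolding uv(2) by simp
    then have "odd (u + v)" by simp
    then have "(u + v) mod 6 = 5" "(u - 5 * v) mod 6 = 5" using uv(1) by presburger+
    moreover have "(u - 5 * v)\<^sup>2 + 5 * (u + v)\<^sup>2 = 24 * int N + 6"
      using uv(2) by (simp add: power2_eq_square algebra_simps)
    ultimately show "z \<in> ?S" using S z by blast
  qed
  also have "\<dots> = card (form5_set (4 * int N + 1))"
    by (intro card_image) (auto simp: inj_on_def)
  finally show ?thesis
    by (subst (asm) odd_card_form5_set) auto
qed

lemma odd_square_mod_8: "odd (x::int) \<Longrightarrow> x\<^sup>2 mod 8 = 1"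
  using tri_index[of x] by simp

text \<open>Odd squares are 1 modulo 8, so \<open>8n + 1\<close> is never five times a square. What
  remains is the condition that \<open>n\<close> is triangular.\<close>

lemma section_0_euler_fps_1_5: "fps_section 0 (euler_fps 1 * euler_fps 5 :: bit fps) = euler_fps 1 ^ 3"
proof (rule fps_ext)
  fix n
  have "4 * int (2 * n) + 1 \<noteq> 5 * x\<^sup>2" for x :: int
  proof
    assume *: "4 * int (2 * n) + 1 = 5 * x\<^sup>2"
    then have "odd (5 * x\<^sup>2)" by (simp flip: *)
    then have "x\<^sup>2 mod 8 = 1" by (intro odd_square_mod_8) auto
    with * show False by presburger
  qed
  then show "fps_nth (fps_section 0 (euler_fps 1 * euler_fps 5 :: bit fps)) n = fps_nth (euler_fps 1 ^ 3) n"
    unfolding euler_fps_cube fps_section_nth euler_fps_1_5_nth by (simp add: tri_fps_def)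
qed

text \<open>Here \<open>8n + 5\<close> is never a square. It is five times a square exactly when
  \<open>n = 5m\<close> with \<open>m\<close> triangular, which is the cube identity with
  \<open>q^5\<close> in place of \<open>q\<close>.\<close>

lemma section_1_euler_fps_1_5: "fps_section 1 (euler_fps 1 * euler_fps 5 :: bit fps) = euler_fps 5 ^ 3"
proof (rule fps_ext)
  fix n
  have no: "4 * int (2 * n + 1) + 1 \<noteq> x\<^sup>2" for x :: int
  proof
    assume *: "4 * int (2 * n + 1) + 1 = x\<^sup>2"
    then have "odd (x\<^sup>2)" by (simp flip: *)
    then have "x\<^sup>2 mod 8 = 1" by (intro odd_square_mod_8) auto
    with * show False by presburger
  qed
  have "fps_nth (euler_fps 5 ^ 3 :: bit fps) n = fps_nth (tri_fps oo fps_X ^ 5) n"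
    by (simp only: euler_fps_compose[of 5] fps_compose_power euler_fps_cube[symmetric]
        fps_X_power_nth) (simp add: fps_compose_power[symmetric] euler_fps_compose[of 5])
  also have "\<dots> = of_bool (5 dvd n \<and> (\<exists>x::int. 8 * int (n div 5) + 1 = x\<^sup>2))"
    by (simp add: fps_nth_compose_X_power tri_fps_def)
  also have "5 dvd n \<and> (\<exists>x::int. 8 * int (n div 5) + 1 = x\<^sup>2) \<longleftrightarrow> (\<exists>x::int. 4 * int (2 * n + 1) + 1 = 5 * x\<^sup>2)"
  proof
    assume *: "5 dvd n \<and> (\<exists>x::int. 8 * int (n div 5) + 1 = x\<^sup>2)"
    then obtain m where n: "n = 5 * m" by (elim conjE dvdE)
    with * obtain x :: int where "8 * int m + 1 = x\<^sup>2" by auto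
    with n show "\<exists>x::int. 4 * int (2 * n + 1) + 1 = 5 * x\<^sup>2" by (intro exI[of _ x]) simp
  next
    assume "\<exists>x::int. 4 * int (2 * n + 1) + 1 = 5 * x\<^sup>2"
    then obtain x :: int where x: "4 * int (2 * n + 1) + 1 = 5 * x\<^sup>2" by blast
    then have "int n mod 5 = 0" by presburger
    then have "5 dvd n" by presburger
    then obtain m where n: "n = 5 * m" by (elim dvdE)
    with x have "8 * int m + 1 = x\<^sup>2" by simp
    with n show "5 dvd n \<and> (\<exists>x::int. 8 * int (n div 5) + 1 = x\<^sup>2)" by auto
  qed
  finally show "fps_nth (fps_section 1 (euler_fps 1 * euler_fps 5 :: bit fps)) n = fps_nth (euler_fps 5 ^ 3) n"
    unfolding fps_section_nth euler_fps_1_5_nth using no by simp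
qed

section \<open>The coefficients at 4n + 2\<close>

text \<open>As \<open>4n + 2 = 2(2n + 1)\<close>, the even part is extracted first and then its odd
  part. Before each extraction both sides are arranged to contain a square, which passes through
  it.\<close>

lemma bit_fps_nth_4n_2:
  fixes F :: "bit fps"
  assumes "F * euler_fps 5 ^ 5 = euler_fps 1"
  shows "fps_nth F (4 * n + 2) = fps_nth (euler_fps 1 * euler_fps 5) n"
proof -
  define P Q where "P = (euler_fps 1 :: bit fps)" and "Q = (euler_fps 5 :: bit fps)"
  have FQ: "F * Q ^ 5 = P" using assms by (simp add: P_def Q_def)
  have Q0: "Q \<noteq> 0" using euler_fps_nth_0[of 5, where ?'a = bit] by (auto simp: Q_def)
  \<comment> \<open>The factor \<open>Q ^ 3\<close> completes \<open>Q ^ 5\<close> to a square and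
    at the same time produces the product \<open>P * Q\<close>, whose dissection is known.\<close>
  have "F * (Q ^ 4)\<^sup>2 = (F * Q ^ 5) * Q ^ 3" by (simp add: eval_nat_numeral mult_ac)
  also have "\<dots> = (P * Q) * Q\<^sup>2" unfolding FQ by (simp add: eval_nat_numeral mult_ac)
  finally have "fps_section 0 F * Q ^ 4 = fps_section 0 (P * Q) * Q"
    by (metis fps_section_mult_square zero_less_numeral)
  then have "fps_section 0 F * (Q\<^sup>2)\<^sup>2 = (P * Q) * P\<^sup>2"
    unfolding P_def Q_def section_0_euler_fps_1_5 by (simp add: eval_nat_numeral mult_ac)
  then have "fps_section 1 (fps_section 0 F) * Q\<^sup>2 = fps_section 1 (P * Q) * P"
    by (metis fps_section_mult_square one_less_numeral_iff semiring_norm(76))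
  also have "\<dots> = (P * Q) * Q\<^sup>2"
    unfolding P_def Q_def section_1_euler_fps_1_5 by (simp add: eval_nat_numeral mult_ac)
  finally have "fps_section 1 (fps_section 0 F) = P * Q" using Q0 by simp
  then have "fps_nth (fps_section 1 (fps_section 0 F)) n = fps_nth (P * Q) n" by simp
  then show ?thesis by (simp add: P_def Q_def)
qed

section \<open>Integrality and reduction modulo 2\<close>

text \<open>With a generic target ring, one integral series can be read both over
  \<open>rat\<close>, where \<open>j10_F\<close> lives, and over \<open>bit\<close>.\<close>

definition fps_of_int :: "int fps \<Rightarrow> 'a::comm_ring_1 fps" where
  "fps_of_int F = Abs_fps (\<lambda>n. of_int (fps_nth F n))"

lemma fps_of_int_nth [simp]: "fps_nth (fps_of_int F) n = of_int (fps_nth F n)"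
  by (simp add: fps_of_int_def)

lemma fps_of_int_mult: "fps_of_int (F * G) = fps_of_int F * fps_of_int G"
  by (simp add: fps_eq_iff fps_mult_nth)

lemma fps_of_int_1: "fps_of_int 1 = 1"
  by (simp add: fps_eq_iff)

lemma fps_of_int_power: "fps_of_int (F ^ n) = fps_of_int F ^ n"
  by (induction n) (simp_all add: fps_of_int_1 fps_of_int_mult)

lemma fps_of_int_prod: "fps_of_int (\<Prod>j\<in>A. F j) = (\<Prod>j\<in>A. fps_of_int (F j))"
  by (induction A rule: infinite_finite_induct) (simp_all add: fps_of_int_1 fps_of_int_mult)

lemma fps_of_int_euler: "fps_of_int (euler_fps k) = euler_fps k"
proof (rule fps_ext)
  fix n
  have "fps_of_int (1 - fps_X ^ m) = (1 - fps_X ^ m :: 'a fps)" for m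
    by (simp add: fps_eq_iff)
  then have "fps_of_int (\<Prod>j\<in>{1..n+1}. 1 - fps_X ^ (k * j)) = (\<Prod>j\<in>{1..n+1}. 1 - fps_X ^ (k * j) :: 'a fps)"
    by (simp only: fps_of_int_prod)
  then show "fps_nth (fps_of_int (euler_fps k)) n = fps_nth (euler_fps k :: 'a fps) n"
    unfolding euler_fps_def fps_of_int_nth fps_nth_Abs_fps by (metis fps_of_int_nth)
qed

text \<open>The denominator has constant term 1 and is therefore invertible over the integers.
  Modulo 2 the Frobenius map turns \<open>euler_fps 2\<close> and \<open>euler_fps 10\<close> into
  squares, after which common factors cancel.\<close>

lemma j10_F_integral:
  obtains G :: "int fps" where "j10_F = fps_of_int G"
    "fps_of_int G * euler_fps 5 ^ 5 = (euler_fps 1 :: bit fps)"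
proof -
  define D :: "int fps" where "D = euler_fps 1 * euler_fps 10 ^ 5"
  \<comment> \<open>The second argument is the inverse of the constant term of
    \<open>D\<close>.\<close>
  define I where "I = fps_right_inverse D 1"
  define G where "G = euler_fps 2 * euler_fps 5 ^ 5 * I"
  have "fps_nth D 0 = 1"
    by (simp add: D_def fps_mult_nth_0 fps_power_zeroth euler_fps_nth_0 euler_fps_nth_0[of "Suc 0"])
  then have DI: "D * I = 1" unfolding I_def by (intro fps_right_inverse) simp
  have q: "qpoch k = euler_fps k" for k by (simp add: qpoch_def euler_fps_def)
  have "fps_of_int D * fps_of_int I = (1 :: rat fps)"
    by (simp add: DI fps_of_int_1 flip: fps_of_int_mult)
  then have inv: "inverse (fps_of_int D) = (fps_of_int I :: rat fps)"
    by (rule fps_inverse_unique)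
  have "j10_F = fps_of_int G"
    unfolding j10_F_def q G_def fps_of_int_mult fps_of_int_power fps_of_int_euler inv[symmetric] D_def ..
  moreover have "fps_of_int G * euler_fps 5 ^ 5 = (euler_fps 1 :: bit fps)"
  proof -
    define P Q where "P = (euler_fps 1 :: bit fps)" and "Q = (euler_fps 5 :: bit fps)"
    have P2: "euler_fps 2 = P\<^sup>2" and Q2: "euler_fps 10 = Q\<^sup>2"
      using euler_fps_double[of 1] euler_fps_double[of 5] by (simp_all add: P_def Q_def)
    have "P \<noteq> 0" "Q \<noteq> 0"
      using euler_fps_nth_0[of 1, where ?'a = bit] euler_fps_nth_0[of 5, where ?'a = bit]
      by (auto simp: P_def Q_def)
    have "G * D = euler_fps 2 * euler_fps 5 ^ 5"
      using DI by (simp add: G_def mult_ac)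
    then have "fps_of_int (G * D) = (fps_of_int (euler_fps 2 * euler_fps 5 ^ 5) :: bit fps)" by simp
    then have "fps_of_int G * (P * (Q\<^sup>2) ^ 5) = P\<^sup>2 * Q ^ 5"
      unfolding D_def fps_of_int_mult fps_of_int_power fps_of_int_euler P2 Q2
      by (simp add: P_def Q_def)
    then have "(fps_of_int G * Q ^ 5) * (P * Q ^ 5) = P * (P * Q ^ 5)"
      by (simp add: eval_nat_numeral mult_ac)
    with \<open>P \<noteq> 0\<close> \<open>Q \<noteq> 0\<close> have "fps_of_int G * Q ^ 5 = P" by simp
    then show ?thesis by (simp add: P_def Q_def)
  qed
  ultimately show ?thesis by (rule that)
qed

text \<open>The factor \<open>1/q\<close> in front of \<open>j10_F\<close> moves the index
  \<open>4n + 1\<close> to \<open>4n + 2\<close>, and the subtracted 1 affects only the constant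
  term of the modular function.\<close>

lemma J10_even_iff:
  "(\<exists>k::int. J10 (4 * n + 1) = of_int (2 * k)) \<longleftrightarrow>
    (\<exists>x::int. 4 * int n + 1 = x\<^sup>2) = (\<exists>x. 4 * int n + 1 = 5 * x\<^sup>2)"
proof -
  obtain G :: "int fps" where G: "j10_F = fps_of_int G"
    "fps_of_int G * euler_fps 5 ^ 5 = (euler_fps 1 :: bit fps)"
    by (rule j10_F_integral)
  have "J10 (4 * n + 1) = of_int (fps_nth G (4 * n + 2))"
    by (simp add: J10_def G(1))
  then have "(\<exists>k::int. J10 (4 * n + 1) = of_int (2 * k)) \<longleftrightarrow> even (fps_nth G (4 * n + 2))"
    unfolding of_int_eq_iff by (simp only: of_int_eq_iff dvd_def)
  also have "\<dots> \<longleftrightarrow> fps_nth (fps_of_int G :: bit fps) (4 * n + 2) = 0"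
    by (simp add: bit_of_int)
  also have "\<dots> \<longleftrightarrow> (\<exists>x::int. 4 * int n + 1 = x\<^sup>2) = (\<exists>x. 4 * int n + 1 = 5 * x\<^sup>2)"
    unfolding bit_fps_nth_4n_2[OF G(2)] euler_fps_1_5_nth by simp
  finally show ?thesis .
qed

section \<open>Density\<close>

text \<open>\<open>n\<close> is determined by \<open>\<bar>x\<bar>\<close>, which is at most
  \<open>sqrt (4 * X + 1)\<close> because \<open>c \<ge> 1\<close>; counting 0 as a possible value
  adds one.\<close>

lemma card_le_square_multiples:
  fixes c :: int and X :: real
  assumes "c > 0" "X \<ge> 0"
  shows "finite {n::nat. real n \<le> X \<and> (\<exists>x. 4 * int n + 1 = c * x\<^sup>2)}"
    and "real (card {n::nat. real n \<le> X \<and> (\<exists>x. 4 * int n + 1 = c * x\<^sup>2)}) \<le> sqrt (4 * X + 1) + 1"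
proof -
  let ?B = "{n::nat. real n \<le> X \<and> (\<exists>x. 4 * int n + 1 = c * x\<^sup>2)}"
  let ?I = "{0..\<lfloor>sqrt (4 * X + 1)\<rfloor>}"
  let ?g = "\<lambda>x::int. nat ((c * x\<^sup>2 - 1) div 4)"
  have sub: "?B \<subseteq> ?g ` ?I"
  proof
    fix n assume "n \<in> ?B"
    then obtain x where n: "real n \<le> X" and x: "4 * int n + 1 = c * x\<^sup>2" by blast
    have "1 * x\<^sup>2 \<le> c * x\<^sup>2" using assms by (intro mult_right_mono) auto
    then have "x\<^sup>2 \<le> 4 * int n + 1" using x by simp
    then have "real_of_int (x\<^sup>2) \<le> real_of_int (4 * int n + 1)" by (simp only: of_int_le_iff)
    then have "(real_of_int \<bar>x\<bar>)\<^sup>2 \<le> 4 * X + 1" using n by simp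
    then have "real_of_int \<bar>x\<bar> \<le> sqrt (4 * X + 1)" by (rule real_le_rsqrt)
    then have "\<bar>x\<bar> \<in> ?I" by (simp add: le_floor_iff)
    moreover have "?g \<bar>x\<bar> = n" using x[symmetric] by simp
    ultimately show "n \<in> ?g ` ?I" by blast
  qed
  then show "finite ?B" by (rule finite_subset) simp
  have "card ?B \<le> card ?I"
    using card_mono[OF _ sub] card_image_le[of ?I ?g] by fastforce
  moreover have "real (card ?I) \<le> sqrt (4 * X + 1) + 1"
    using assms by (simp add: le_floor_iff)
  ultimately show "real (card ?B) \<le> sqrt (4 * X + 1) + 1" by linarith
qed

theorem theorem4p1:
  shows "((\<lambda>X::real. real (card {n::nat. real n \<le> X \<and> (\<exists>k::int. J10 (4 * n + 1) = of_int (2 * k))}) / X)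
          \<longlongrightarrow> 1) at_top"
proof (rule tendsto_sandwich)
  let ?A = "\<lambda>X. {n::nat. real n \<le> X \<and> (\<exists>k::int. J10 (4 * n + 1) = of_int (2 * k))}"
  \<comment> \<open>Odd values can occur only on the sets \<open>?B 1\<close> and
    \<open>?B 5\<close>, each of size of order \<open>sqrt X\<close>. The upper bound counts all
    \<open>n \<le> X\<close>, including 0.\<close>
  have bounds: "X - 2 * (sqrt (4 * X + 1) + 1) \<le> real (card (?A X)) \<and> real (card (?A X)) \<le> X + 1"
    if "X > 0" for X :: real
  proof -
    let ?N = "{n::nat. real n \<le> X}"
    let ?B = "\<lambda>c::int. {n::nat. real n \<le> X \<and> (\<exists>x. 4 * int n + 1 = c * x\<^sup>2)}"
    have N: "?N = {..nat \<lfloor>X\<rfloor>}" using that by (auto simp: le_nat_floor le_floor_iff) linarith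
    have cN: "X \<le> real (card ?N)" "real (card ?N) \<le> X + 1"
      using that unfolding N by (simp_all, linarith+)
    have "?N \<subseteq> ?A X \<union> ?B 1 \<union> ?B 5" unfolding J10_even_iff by auto
    then have "card ?N \<le> card (?A X \<union> ?B 1 \<union> ?B 5)"
      using N by (intro card_mono) (auto intro: finite_subset[of _ ?N])
    also have "\<dots> \<le> card (?A X) + card (?B 1) + card (?B 5)"
      using card_Un_le[of "?A X \<union> ?B 1" "?B 5"] card_Un_le[of "?A X" "?B 1"] by linarith
    finally have "X \<le> real (card (?A X)) + real (card (?B 1)) + real (card (?B 5))"
      using cN(1) by linarith
    moreover have "real (card (?A X)) \<le> real (card ?N)"
      unfolding of_nat_le_iff using N by (intro card_mono) auto
    moreover have "real (card (?B 1)) \<le> sqrt (4 * X + 1) + 1" "real (card (?B 5)) \<le> sqrt (4 * X + 1) + 1"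
      using that by (intro card_le_square_multiples(2); simp)+
    ultimately show ?thesis using cN(2) by argo
  qed
  show "\<forall>\<^sub>F X in at_top. (X - 2 * (sqrt (4 * X + 1) + 1)) / X \<le> real (card (?A X)) / X"
    using eventually_gt_at_top[of "0::real"] by eventually_elim (use bounds in \<open>simp add: divide_right_mono\<close>)
  show "\<forall>\<^sub>F X in at_top. real (card (?A X)) / X \<le> (X + 1) / X"
    using eventually_gt_at_top[of "0::real"] by eventually_elim (use bounds in \<open>simp add: divide_right_mono\<close>)
  show "((\<lambda>X::real. (X - 2 * (sqrt (4 * X + 1) + 1)) / X) \<longlongrightarrow> 1) at_top" by real_asymp
  show "((\<lambda>X::real. (X + 1) / X) \<longlongrightarrow> 1) at_top" by real_asymp
qed
end
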